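(* Let $\Omega\subset\mathbb{C}^d$ be a hyperbolic domain (not necessarily bounded). Suppose that for some $\lambda\geq 1$, $\kappa\geq 0$, and some totally disconnected set $S\subset\partial\Omega$, every pair of distinct points of $\partial\Omega\setminus S$ satisfies the visibility property with respect to $(\lambda,\kappa)$-almost-geodesics for $\mathsf{k}_\Omega$. Then $\Omega$ is a $(\lambda,\kappa)$-visibility domain, i.e. every pair of distinct points of $\partial\overline{\Omega}^{End}$ satisfies the visibility property with respect to $(\lambda,\kappa)$-almost-geodesics for $\mathsf{k}_\Omega$.
   Context: For a domain $\Omega\subset\mathbb{C}^d$, $\mathsf{k}_\Omega$ is the Kobayashi (pseudo)distance and $\kappa_\Omega(z;v)$ the Kobayashi--Royden (pseudo)metric; $\Omega$ is hyperbolic if $\mathsf{k}_\Omega$ is a distance. $\partial\Omega$ is the Euclidean boundary in $\mathbb{C}^d$. Almost-geodesics: for $\lambda\ge1,\kappa\ge0$ and an interval $I\subset\mathbb{R}$, a map $\sigma:I\to\Omega$ is a $(\lambda,\kappa)$-almost-geodesic (for $\mathsf{k}_\Omega$) if (i) $\frac1\lambda|s-t|-\kappa\le \mathsf{k}_\Omega(\sigma(s),\sigma(t))\le\lambda|s-t|+\kappa$ for all $s,t\in I$; (ii) $\sigma$ is absolutely continuous and $\kappa_\Omega(\sigma(t);\sigma'(t))\le\lambda$ for a.e. $t\in I$. End compactification: if $\Omega$ is bounded, $\overline{\Omega}^{End}:=\overline{\Omega}$. If $\Omega$ is unbounded, fix an exhaustion $(K_j)_{j\ge1}$ of $\overline\Omega$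 by compact sets with $K_j$ contained in the interior (in $\overline\Omega$) of $K_{j+1}$. An end of $\overline\Omega$ is a sequence $(F_j)_{j\ge1}$ with $F_j$ a connected component of $\overline\Omega\setminus K_j$ and $F_{j+1}\subset F_j$. As a set, $\overline{\Omega}^{End}$ is $\overline\Omega$ together with all ends. Points of $\overline\Omega$ have their Euclidean neighbourhoods in $\overline\Omega$ as neighbourhood basis; an end $(F_j)_j$ has the neighbourhood basis $(\widehat F_j)_j$, where $\widehat F_j$ is $F_j$ together with all ends $(G_\nu)_\nu$ with $G_\nu=F_\nu$ for $\nu=1,\dots,j$. (Up to natural homeomorphism this does not depend on the exhaustion.) $\partial\overline{\Omega}^{End}:=\overline{\Omega}^{End}\setminus\Omega$. Visibility of a pair: distinct $\zeta,\eta\in\partial\overline{\Omega}^{End}$ satisfy the visibility property with respect to $(\lambda,\kappa)$-almost-geodesics (the $(\lambda,\kappa)$-visibility property) if there exist neighbourhoods $V_\zeta$ of $\zeta$ and $V_\eta$ of $\eta$ in $\overline{\Omega}^{End}$ with $\overline{V_\zeta}\cap\overline{V_\eta}=\emptyset$ and a compact $K\subset\Omega$ such that every $(\lambda,\kappa)$-almost-geodesic $\sigma:[0,T]\to\Omega$ for $\mathsf{k}_\Omega$ with $\sigma(0)\in V_\zeta$, $\sigma(T)\in V_\eta$ satisfies $\sigma([0,T])\cap K\ne\emptyset$. *)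

theory Defs
  imports "HOL-Complex_Analysis.Complex_Analysis"
begin

section \<open>The Kobayashi distance and the Kobayashi--Royden metric\<close>

definition domain :: "(complex ^ 'n) set \<Rightarrow> bool" where
  "domain \<Omega> \<longleftrightarrow> open \<Omega> \<and> connected \<Omega> \<and> \<Omega> \<noteq> {}"

definition analytic_discs :: "(complex ^ 'n) set \<Rightarrow> (complex \<Rightarrow> complex ^ 'n) set" where
  "analytic_discs \<Omega> =
     {f. (\<forall>i. (\<lambda>z. f z $ i) holomorphic_on ball 0 1) \<and> f ` ball 0 1 \<subseteq> \<Omega>}"

text \<open>Normalised as the integrated form of $|dz|/(1-|z|^2)$, so that the Kobayashi distance below
  is the integrated form of the Kobayashi--Royden metric below.\<close>

definition poincare_dist :: "complex \<Rightarrow> complex \<Rightarrow> real" where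
  "poincare_dist z w = artanh (cmod ((z - w) / (1 - cnj w * z)))"

definition kobayashi_dist :: "(complex ^ 'n) set \<Rightarrow> complex ^ 'n \<Rightarrow> complex ^ 'n \<Rightarrow> real" where
  "kobayashi_dist \<Omega> z w = Inf {(\<Sum>i<n. poincare_dist (a i) (b i)) | n p f a b.
     (0::nat) < n \<and> p 0 = z \<and> p n = w \<and>
     (\<forall>i<n. f i \<in> analytic_discs \<Omega> \<and> a i \<in> ball 0 1 \<and> b i \<in> ball 0 1 \<and>
            f i (a i) = p i \<and> f i (b i) = p (Suc i))}"

definition kobayashi_metric :: "(complex ^ 'n) set \<Rightarrow> complex ^ 'n \<Rightarrow> complex ^ 'n \<Rightarrow> real" where
  "kobayashi_metric \<Omega> z v = Inf {cmod \<xi> | \<xi> f.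
     f \<in> analytic_discs \<Omega> \<and> f 0 = z \<and> (\<forall>i. deriv (\<lambda>w. f w $ i) 0 * \<xi> = v $ i)}"

text \<open>The locale \<^locale>\<open>Metric_space\<close> asks for symmetry and nonnegativity on the whole type,
  whereas \<^const>\<open>kobayashi_dist\<close> is meaningful on \<open>\<Omega> \<times> \<Omega>\<close> only; hence the extension by zero.\<close>

definition hyperbolic :: "(complex ^ 'n) set \<Rightarrow> bool" where
  "hyperbolic \<Omega> \<longleftrightarrow>
     Metric_space \<Omega> (\<lambda>z w. if z \<in> \<Omega> \<and> w \<in> \<Omega> then kobayashi_dist \<Omega> z w else 0)"


section \<open>Almost-geodesics\<close>

definition abs_continuous_on :: "real set \<Rightarrow> (real \<Rightarrow> 'a::metric_space) \<Rightarrow> bool" where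
  "abs_continuous_on I \<sigma> \<longleftrightarrow>
     (\<forall>\<epsilon>>0. \<exists>\<delta>>0. \<forall>(n::nat) a b.
        (\<forall>i<n. a i \<le> b i \<and> {a i..b i} \<subseteq> I) \<and>
        (\<forall>i<n. \<forall>j<n. i \<noteq> j \<longrightarrow> {a i<..<b i} \<inter> {a j<..<b j} = {}) \<and>
        (\<Sum>i<n. b i - a i) < \<delta>
        \<longrightarrow> (\<Sum>i<n. dist (\<sigma> (a i)) (\<sigma> (b i))) < \<epsilon>)"

text \<open>The derivative of an absolutely continuous \<open>\<sigma>\<close> exists almost everywhere, so asserting its
  existence inside the almost-everywhere clause adds nothing.\<close>

definition almost_geodesic ::
  "real \<Rightarrow> real \<Rightarrow> (complex ^ 'n) set \<Rightarrow> real set \<Rightarrow> (real \<Rightarrow> complex ^ 'n) \<Rightarrow> bool" where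
  "almost_geodesic lam kap \<Omega> I \<sigma> \<longleftrightarrow>
     \<sigma> ` I \<subseteq> \<Omega> \<and>
     (\<forall>s\<in>I. \<forall>t\<in>I. \<bar>s - t\<bar> / lam - kap \<le> kobayashi_dist \<Omega> (\<sigma> s) (\<sigma> t) \<and>
                  kobayashi_dist \<Omega> (\<sigma> s) (\<sigma> t) \<le> lam * \<bar>s - t\<bar> + kap) \<and>
     abs_continuous_on I \<sigma> \<and>
     (AE t in lebesgue_on I.
        \<exists>v. (\<sigma> has_vector_derivative v) (at t within I) \<and> kobayashi_metric \<Omega> (\<sigma> t) v \<le> lam)"


section \<open>The end compactification\<close>

definition exhaustion :: "'a::euclidean_space set \<Rightarrow> (nat \<Rightarrow> 'a set) \<Rightarrow> bool" where
  "exhaustion X K \<longleftrightarrow>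
     (\<forall>j. compact (K j) \<and> K j \<subseteq> X \<and> K j \<subseteq> top_of_set X interior_of K (Suc j)) \<and>
     (\<Union>j. K j) = X"

definition ends :: "'a::euclidean_space set \<Rightarrow> (nat \<Rightarrow> 'a set) \<Rightarrow> (nat \<Rightarrow> 'a set) set" where
  "ends X K = {F. \<forall>j. F j \<in> components (X - K j) \<and> F (Suc j) \<subseteq> F j}"

datatype 'a end_point = Pt 'a | End "nat \<Rightarrow> 'a set"

definition end_compactification ::
  "'a::euclidean_space set \<Rightarrow> (nat \<Rightarrow> 'a set) \<Rightarrow> 'a end_point set" where
  "end_compactification \<Omega> K =
     (if bounded \<Omega> then Pt ` closure \<Omega> else Pt ` closure \<Omega> \<union> End ` ends (closure \<Omega>) K)"

definition end_boundary ::
  "'a::euclidean_space set \<Rightarrow> (nat \<Rightarrow> 'a set) \<Rightarrow> 'a end_point set" where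
  "end_boundary \<Omega> K = end_compactification \<Omega> K - Pt ` \<Omega>"

definition end_hat ::
  "'a::euclidean_space set \<Rightarrow> (nat \<Rightarrow> 'a set) \<Rightarrow> (nat \<Rightarrow> 'a set) \<Rightarrow> nat \<Rightarrow> 'a end_point set" where
  "end_hat \<Omega> K F j = Pt ` F j \<union> End ` {G \<in> ends (closure \<Omega>) K. \<forall>i\<le>j. G i = F i}"

text \<open>The neighbourhoods of a point are exactly the supersets of the members of its prescribed
  neighbourhood basis, and closures are formed with these neighbourhoods. The neighbourhood
  systems, rather than a family of open sets, are taken as primitive because \<open>closure \<Omega>\<close> need not
  be locally connected at the boundary of \<open>\<Omega>\<close>: a component \<open>F j\<close> of \<open>closure \<Omega> - K j\<close> may fail to
  be relatively open, and then \<open>end_hat \<Omega> K F j\<close> would not be a neighbourhood of the end \<open>F\<close> in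
  the topology whose open sets are the sets that are neighbourhoods of all their points. If these
  components are relatively open, both descriptions agree.\<close>

definition end_nhd ::
  "'a::euclidean_space set \<Rightarrow> (nat \<Rightarrow> 'a set) \<Rightarrow> 'a end_point \<Rightarrow> 'a end_point set \<Rightarrow> bool" where
  "end_nhd \<Omega> K \<zeta> V \<longleftrightarrow> V \<subseteq> end_compactification \<Omega> K \<and>
     (case \<zeta> of
        Pt x \<Rightarrow> \<exists>e>0. Pt ` (ball x e \<inter> closure \<Omega>) \<subseteq> V
      | End F \<Rightarrow> \<exists>j. end_hat \<Omega> K F j \<subseteq> V)"

definition end_closure ::
  "'a::euclidean_space set \<Rightarrow> (nat \<Rightarrow> 'a set) \<Rightarrow> 'a end_point set \<Rightarrow> 'a end_point set" where
  "end_closure \<Omega> K V =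
     {\<zeta> \<in> end_compactification \<Omega> K. \<forall>U. end_nhd \<Omega> K \<zeta> U \<longrightarrow> U \<inter> V \<noteq> {}}"


section \<open>Visibility\<close>

definition visible_pair ::
  "real \<Rightarrow> real \<Rightarrow> (complex ^ 'n) set \<Rightarrow> (nat \<Rightarrow> (complex ^ 'n) set) \<Rightarrow>
   (complex ^ 'n) end_point \<Rightarrow> (complex ^ 'n) end_point \<Rightarrow> bool" where
  "visible_pair lam kap \<Omega> K \<zeta> \<eta> \<longleftrightarrow>
     (\<exists>V W C. end_nhd \<Omega> K \<zeta> V \<and> end_nhd \<Omega> K \<eta> W \<and>
        end_closure \<Omega> K V \<inter> end_closure \<Omega> K W = {} \<and>
        compact C \<and> C \<subseteq> \<Omega> \<and>
        (\<forall>T\<ge>0. \<forall>\<sigma>. almost_geodesic lam kap \<Omega> {0..T} \<sigma> \<and> Pt (\<sigma> 0) \<in> V \<and> Pt (\<sigma> T) \<in> W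
           \<longrightarrow> \<sigma> ` {0..T} \<inter> C \<noteq> {}))"

definition visibility_domain ::
  "real \<Rightarrow> real \<Rightarrow> (complex ^ 'n) set \<Rightarrow> (nat \<Rightarrow> (complex ^ 'n) set) \<Rightarrow> bool" where
  "visibility_domain lam kap \<Omega> K \<longleftrightarrow>
     (\<forall>\<zeta>\<in>end_boundary \<Omega> K. \<forall>\<eta>\<in>end_boundary \<Omega> K. \<zeta> \<noteq> \<eta> \<longrightarrow> visible_pair lam kap \<Omega> K \<zeta> \<eta>)"

definition totally_disconnected :: "'a::topological_space set \<Rightarrow> bool" where
  "totally_disconnected S \<longleftrightarrow> (\<forall>C\<subseteq>S. connected C \<longrightarrow> (\<exists>a. C \<subseteq> {a}))"

end

theory Submission
  imports Defs
begin

text \<open>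
  Suppose a pair of boundary points or ends is not visible. Then there are almost-geodesics
  \<open>\<sigma>\<^sub>n\<close> in \<open>\<Omega>\<close> that leave every compact subset of \<open>\<Omega>\<close>, and all of them cross a fixed
  spherical shell: if one of the two points is finite, choose the centre there, and if both are
  ends, note that \<open>\<sigma>\<^sub>n\<close> has to meet a compact set separating the ends. Inside a shell the upper
  limit of the crossing arcs is a nondegenerate continuum in \<open>\<partial>\<Omega>\<close>, so it is not contained in
  the totally disconnected set \<open>S\<close>. Applied to two disjoint subshells this yields distinct
  \<open>p, q \<in> \<partial>\<Omega> - S\<close> that are limits of points on the same \<open>\<sigma>\<^sub>n\<close>, and the subarcs of \<open>\<sigma>\<^sub>n\<close>
  between these points contradict the visibility of \<open>p\<close> and \<open>q\<close>.
\<close>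

section \<open>Upper limits of connected sets\<close>

text \<open>If the limit set split into two disjoint closed pieces, disjoint open sets
  \<open>U1\<close> and \<open>U2\<close> around them would contain all late \<open>B n\<close>.
  Each connected \<open>B n\<close> then lies in one of the two. The convergent points
  \<open>b n\<close> force the same choice for all large \<open>n\<close>, so the other piece would
  be empty. Without such an anchor the sets could alternate between two distant places.\<close>

lemma connected_limsup:
  fixes B :: "nat \<Rightarrow> 'a::{heine_borel,t4_space} set"
  assumes "compact A" and B: "\<And>n. connected (B n)" "\<And>n. B n \<subseteq> A"
    and b: "\<And>n. b n \<in> B n" "b \<longlonglongrightarrow> l"
  shows "connected (\<Inter>m. closure (\<Union>n\<in>{m..}. B n))" (is "connected ?L")
proof (rule ccontr)
  assume nc: "\<not> connected ?L"
  have clL: "closed ?L"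
    by auto
  have lL: "l \<in> ?L"
  proof
    fix m :: nat
    have "(\<lambda>n. b (n + m)) \<longlonglongrightarrow> l"
      using b(2) by (rule LIMSEQ_ignore_initial_segment)
    then show "l \<in> closure (\<Union>n\<in>{m..}. B n)"
      unfolding closure_sequential using b(1)
      by (intro exI[of _ "\<lambda>n. b (n + m)"]) (auto intro!: bexI[where x="_ + m"])
  qed
  obtain L1 L2 where L: "closed L1" "closed L2" "L1 \<union> L2 = ?L" "L1 \<inter> L2 = {}" "l \<in> L1" "L2 \<noteq> {}"
  proof -
    from nc obtain E F where "closed E" "closed F" "E \<noteq> {}" "F \<noteq> {}" "E \<union> F = ?L" "E \<inter> F = {}"
      unfolding connected_closed_set[OF clL] by metis
    with lL that[of E F] that[of F E] show ?thesis
      by (metis Int_commute Un_commute UnE)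
  qed
  obtain U1 U2 where U: "open U1" "open U2" "L1 \<subseteq> U1" "L2 \<subseteq> U2" "U1 \<inter> U2 = {}"
    using t4_space[OF L(1,2,4)] by metis
  have subA: "closure (\<Union>n\<in>{m..}. B n) \<subseteq> A" for m
    by (rule closure_minimal) (use B(2) \<open>compact A\<close> compact_imp_closed in auto)
  \<comment> \<open>Otherwise the closures of the tails minus \<open>U1 \<union> U2\<close> form a
    decreasing sequence of nonempty compact sets, and a common point would be a point of the limit
    set outside both pieces.\<close>
  have "\<exists>m. closure (\<Union>n\<in>{m..}. B n) \<subseteq> U1 \<union> U2"
  proof (rule ccontr)
    assume *: "\<not> ?thesis"
    have "(\<Inter>m. closure (\<Union>n\<in>{m..}. B n) - (U1 \<union> U2)) \<noteq> {}"
    proof (rule compact_nest)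
      fix m :: nat
      have "closure (\<Union>n\<in>{m..}. B n) - (U1 \<union> U2) = A \<inter> (closure (\<Union>n\<in>{m..}. B n) - (U1 \<union> U2))"
        using subA by blast
      moreover have "closed (closure (\<Union>n\<in>{m..}. B n) - (U1 \<union> U2))"
        using U by auto
      ultimately show "compact (closure (\<Union>n\<in>{m..}. B n) - (U1 \<union> U2))"
        using \<open>compact A\<close> by (metis compact_Int_closed)
      show "closure (\<Union>n\<in>{m..}. B n) - (U1 \<union> U2) \<noteq> {}"
        using * by auto
    next
      fix m n :: nat
      assume "m \<le> n"
      then show "closure (\<Union>i\<in>{n..}. B i) - (U1 \<union> U2) \<subseteq> closure (\<Union>i\<in>{m..}. B i) - (U1 \<union> U2)"
        by (intro Diff_mono closure_mono UN_mono) auto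
    qed
    then show False
      using L(3) U(3,4) by blast
  qed
  then obtain m where m: "closure (\<Union>n\<in>{m..}. B n) \<subseteq> U1 \<union> U2" ..
  have "\<forall>\<^sub>F n in sequentially. b n \<in> U1"
    using b(2) U(1,3) L(5) by (auto intro: topological_tendstoD)
  then obtain N where N: "\<And>n. n \<ge> N \<Longrightarrow> b n \<in> U1"
    unfolding eventually_sequentially by blast
  have "B n \<inter> U2 = {}" if n: "n \<ge> max m N" for n
  proof -
    have "B n \<subseteq> U1 \<union> U2"
      using m n closure_subset[of "\<Union>n\<in>{m..}. B n"] by fastforce
    moreover have "b n \<in> U1 \<inter> B n"
      using N b(1) n by auto
    ultimately show ?thesis
      using connectedD[OF B(1)[of n] U(1,2)] U(5) by blast
  qed
  then have "(\<Union>n\<in>{max m N..}. B n) \<inter> U2 = {}"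
    by (metis UN_E atLeast_iff disjoint_iff)
  then have "closure (\<Union>n\<in>{max m N..}. B n) \<inter> U2 = {}"
    using open_Int_closure_eq_empty[OF U(2)] by blast
  then show False
    using L(3,6) U(4) by blast
qed

text \<open>The points of \<open>B n\<close> on the two bounding spheres subconverge to points at
  distances \<open>a\<close> and \<open>b\<close> from \<open>c\<close>. Hence the connected upper
  limit has more than one point and cannot lie in \<open>S\<close>. The indices \<open>k\<close> are
  returned together with \<open>p\<close>, so that a second limit can be taken along the same
  subfamily; \<open>n \<le> k n\<close> is enough for that, monotonicity is not asked for.\<close>

lemma crossing_sequence_limit:
  fixes \<Omega> S :: "'a::euclidean_space set"
  assumes "totally_disconnected S" and ab: "a < b"
    and B: "\<And>n. connected (B n)" "\<And>n. B n \<subseteq> \<Omega>" "\<And>n. dist c ` B n \<subseteq> {a..b}"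
      "\<And>n. a \<in> dist c ` B n" "\<And>n. b \<in> dist c ` B n"
    and avoid: "\<And>C. \<lbrakk>compact C; C \<subseteq> \<Omega>\<rbrakk> \<Longrightarrow> \<forall>\<^sub>F n in sequentially. B n \<inter> C = {}"
    and "open \<Omega>"
  obtains p z and k :: "nat \<Rightarrow> nat"
  where "p \<in> frontier \<Omega> - S" "dist c p \<in> {a..b}" "\<And>n. n \<le> k n" "\<And>n. z n \<in> B (k n)" "z \<longlonglongrightarrow> p"
proof -
  have comp: "compact (cball c b)"
    by simp
  have Bc: "B n \<subseteq> cball c b" for n
    using B(3)[of n] by auto
  have "\<forall>n. \<exists>x. x \<in> B n \<and> dist c x = a"
    using B(4) by (simp add: image_iff) (metis)
  then obtain x where x: "\<And>n. x n \<in> B n" "\<And>n. dist c (x n) = a"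
    by metis
  have "\<forall>n. \<exists>x. x \<in> B n \<and> dist c x = b"
    using B(5) by (simp add: image_iff) (metis)
  then obtain y where y: "\<And>n. y n \<in> B n" "\<And>n. dist c (y n) = b"
    by metis
  have "\<forall>n. x n \<in> cball c b" "\<forall>n. y n \<in> cball c b"
    using x y Bc by blast+
  then obtain l r where l: "strict_mono r" "(x \<circ> r) \<longlonglongrightarrow> l"
    using comp unfolding compact_def by meson
  have "\<forall>n. (y \<circ> r) n \<in> cball c b"
    using y Bc by auto
  then obtain l' r' where l': "strict_mono r'" "((y \<circ> r) \<circ> r') \<longlonglongrightarrow> l'"
    using comp unfolding compact_def by meson
  \<comment> \<open>Two successive extractions make the points on both spheres converge along one
    subsequence, so both limits belong to the same upper limit \<open>L\<close>.\<close>
  define q where "q = r \<circ> r'"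
  have q: "strict_mono q" "(\<lambda>n. x (q n)) \<longlonglongrightarrow> l" "(\<lambda>n. y (q n)) \<longlonglongrightarrow> l'"
    using l l' LIMSEQ_subseq_LIMSEQ[OF l(2) l'(1)]
      strict_mono_o[OF l(1) l'(1)]
    by (simp_all add: q_def o_def)
  define L where "L = (\<Inter>m. closure (\<Union>n\<in>{m..}. B (q n)))"
  have "connected L"
    unfolding L_def by (rule connected_limsup[OF comp B(1) Bc x(1) q(2)])
  have inL: "z \<in> L" if "\<And>n. w n \<in> B (q n)" "w \<longlonglongrightarrow> z" for w z
    unfolding L_def
  proof
    fix m :: nat
    have "(\<lambda>n. w (n + m)) \<longlonglongrightarrow> z"
      using that(2) by (rule LIMSEQ_ignore_initial_segment)
    then show "z \<in> closure (\<Union>n\<in>{m..}. B (q n))"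
      unfolding closure_sequential using that(1)
      by (intro exI[of _ "\<lambda>n. w (n + m)"]) (auto intro!: bexI[where x="_ + m"])
  qed
  have "dist c l = a"
    using LIMSEQ_unique[OF tendsto_dist[OF tendsto_const q(2), of c]] x(2) by simp
  moreover have "dist c l' = b"
    using LIMSEQ_unique[OF tendsto_dist[OF tendsto_const q(3), of c]] y(2) by simp
  moreover have "l \<in> L" "l' \<in> L"
    using inL[OF x(1) q(2)] inL[OF y(1) q(3)] .
  ultimately have "\<not> (\<exists>d. L \<subseteq> {d})"
    using ab by (metis less_irrefl singletonD subsetD)
  then have "\<not> L \<subseteq> S"
    using \<open>connected L\<close> assms(1) unfolding totally_disconnected_def by blast
  then obtain p where p: "p \<in> L" "p \<notin> S"
    by blast
  \<comment> \<open>Membership in the closure of the \<open>n\<close>-th tail gives a point of some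
    \<open>B (q i)\<close> with \<open>n \<le> i\<close>, and \<open>i \<le> q i\<close> since
    \<open>q\<close> is strictly increasing.\<close>
  have "\<exists>k z. n \<le> k \<and> z \<in> B k \<and> dist z p < inverse (real (Suc n))" for n
  proof -
    have "p \<in> closure (\<Union>i\<in>{n..}. B (q i))"
      using p(1) unfolding L_def by blast
    then obtain i z where "n \<le> i" "z \<in> B (q i)" "dist z p < inverse (real (Suc n))"
      unfolding closure_approachable by (force dest: spec[of _ "inverse (real (Suc n))"])
    then show ?thesis
      using seq_suble[OF q(1), of i] by (meson order_trans)
  qed
  then obtain k z where kz: "\<And>n. n \<le> k n" "\<And>n. z n \<in> B (k n)"
      "\<And>n. dist (z n) p < inverse (real (Suc n))"
    by metis
  have zp: "z \<longlonglongrightarrow> p"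
  proof (rule metric_LIMSEQ_I)
    fix e :: real
    assume "e > 0"
    then obtain N where N: "inverse (real (Suc N)) < e"
      using reals_Archimedean by blast
    have "dist (z n) p < e" if "n \<ge> N" for n
    proof -
      have "inverse (real (Suc n)) \<le> inverse (real (Suc N))"
        using that by (simp add: field_simps)
      then show ?thesis
        using kz(3)[of n] N by linarith
    qed
    then show "\<exists>N. \<forall>n\<ge>N. dist (z n) p < e"
      by blast
  qed
  have "dist c (z n) \<in> {a..b}" for n
    using kz(2) B(3) by blast
  moreover have "(\<lambda>n. dist c (z n)) \<longlonglongrightarrow> dist c p"
    by (intro tendsto_intros zp)
  ultimately have "dist c p \<in> {a..b}"
    using closed_sequentially[of "{a..b}" "\<lambda>n. dist c (z n)"] by auto
  moreover have "p \<in> closure \<Omega>"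
    unfolding closure_sequential using zp kz(2) B(2) by blast
  \<comment> \<open>A closed ball around \<open>p\<close> inside \<open>\<Omega>\<close> would be a
    compact set that all late \<open>B n\<close> avoid, although the \<open>z n\<close> enter
    it.\<close>
  moreover have "p \<notin> \<Omega>"
  proof
    assume "p \<in> \<Omega>"
    then obtain e where e: "e > 0" "cball p e \<subseteq> \<Omega>"
      using \<open>open \<Omega>\<close> open_contains_cball by blast
    obtain N where N: "\<And>n. n \<ge> N \<Longrightarrow> B n \<inter> cball p e = {}"
      using avoid[OF compact_cball e(2)] unfolding eventually_sequentially by blast
    obtain M where M: "\<And>n. n \<ge> M \<Longrightarrow> dist (z n) p < e"
      using metric_LIMSEQ_D[OF zp e(1)] by blast
    have "B (k (max M N)) \<inter> cball p e = {}"
      using N kz(1)[of "max M N"] by simp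
    moreover have "z (max M N) \<in> cball p e"
      using M[of "max M N"] by (simp add: dist_commute)
    ultimately show False
      using kz(2) by blast
  qed
  ultimately show thesis
    using that[OF _ _ kz(1) kz(2) zp] p(2) \<open>open \<Omega>\<close> by (simp add: frontier_def interior_open)
qed

section \<open>Crossing a range of values along an interval\<close>

text \<open>Take \<open>v\<close> as the first time at level \<open>b\<close> and \<open>u\<close>
  as the last time before \<open>v\<close> at level \<open>a\<close>; both exist because level sets
  are compact. By the intermediate value theorem, a value above \<open>b\<close> between them would
  force an earlier hit of \<open>b\<close>, and a value below \<open>a\<close> a later hit of
  \<open>a\<close>.\<close>

lemma crossing_interval:
  fixes f :: "real \<Rightarrow> real"
  assumes f: "continuous_on {s..t} f" and "s \<le> t" "f s \<le> a" "a < b" "b \<le> f t"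
  obtains u v where "s \<le> u" "u \<le> v" "v \<le> t" "f u = a" "f v = b" "f ` {u..v} \<subseteq> {a..b}"
proof -
  have fi: "continuous_on {x..y} f" if "s \<le> x" "y \<le> t" for x y
    using f by (rule continuous_on_subset) (use that in auto)
  have closed_level: "compact {w\<in>{x..y}. f w = d}" if "s \<le> x" "y \<le> t" for x y d
    using continuous_closed_preimage_constant[OF fi[OF that], of d]
    by (auto simp: compact_eq_bounded_closed intro: bounded_subset[OF bounded_closed_interval])
  have "{w\<in>{s..t}. f w = b} \<noteq> {}"
    using IVT'[of f s b t] f assms by force
  then obtain v where v: "v \<in> {s..t}" "f v = b" "\<And>w. w \<in> {s..t} \<Longrightarrow> f w = b \<Longrightarrow> v \<le> w"
    using compact_attains_inf[OF closed_level[of s t b]] by auto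
  have "{w\<in>{s..v}. f w = a} \<noteq> {}"
    using IVT'[of f s a v] fi[of s v] v assms by force
  then obtain u where u: "u \<in> {s..v}" "f u = a" "\<And>w. w \<in> {s..v} \<Longrightarrow> f w = a \<Longrightarrow> w \<le> u"
    using compact_attains_sup[OF closed_level[of s v a]] v by auto
  have "f w \<in> {a..b}" if w: "w \<in> {u..v}" for w
  proof -
    have "f w \<le> b"
    proof (rule ccontr)
      assume "\<not> f w \<le> b"
      then obtain x where "s \<le> x" "x \<le> w" "f x = b"
        using IVT'[of f s b w] fi[of s w] w u v assms by force
      moreover from this have "v \<le> x"
        using v(3)[of x] w u(1) v(1) by auto
      ultimately have "x = w"
        using w by auto
      then show False
        using \<open>f x = b\<close> \<open>\<not> f w \<le> b\<close> by simp
    qed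
    moreover have "a \<le> f w"
    proof (rule ccontr)
      assume "\<not> a \<le> f w"
      then obtain x where "w \<le> x" "x \<le> v" "f x = a"
        using IVT'[of f w a v] fi[of w v] w u v assms by force
      moreover from this have "x \<le> u"
        using u(3)[of x] w u(1) by auto
      ultimately have "x = w"
        using w by auto
      then show False
        using \<open>f x = a\<close> \<open>\<not> a \<le> f w\<close> by simp
    qed
    ultimately show ?thesis
      by simp
  qed
  then have "f ` {u..v} \<subseteq> {a..b}"
    by blast
  then show thesis
    using that[of u v] u v by simp
qed

text \<open>The low value may be taken after the high one; reversing the parameter reduces that case
  to the previous lemma.\<close>

lemma crossing_connected:
  fixes f :: "real \<Rightarrow> real"
  assumes f: "continuous_on {x..y} f" and st: "s \<in> {x..y}" "t \<in> {x..y}"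
    and "f s \<le> a" "a < b" "b \<le> f t"
  obtains J where "connected J" "J \<subseteq> {x..y}" "a \<in> f ` J" "b \<in> f ` J" "f ` J \<subseteq> {a..b}"
proof (cases "s \<le> t")
  case True
  have "continuous_on {s..t} f"
    using f by (rule continuous_on_subset) (use st in auto)
  then obtain u v where "s \<le> u" "u \<le> v" "v \<le> t" "f u = a" "f v = b" "f ` {u..v} \<subseteq> {a..b}"
    using crossing_interval True assms by metis
  then show thesis
    using that[of "{u..v}"] st by force
next
  case False
  have "continuous_on {-s..-t} (\<lambda>w. f (- w))"
    by (rule continuous_on_compose2[OF f]) (use st in \<open>auto intro!: continuous_intros\<close>)
  then obtain u v where uv: "-s \<le> u" "u \<le> v" "v \<le> -t" "f (-u) = a" "f (-v) = b"
      "(\<lambda>w. f (- w)) ` {u..v} \<subseteq> {a..b}"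
    using crossing_interval[of "-s" "-t" "\<lambda>w. f (- w)" a b] False assms by auto
  have "f ` {-v..-u} = (\<lambda>w. f (- w)) ` {u..v}"
    by (simp add: image_image[symmetric, of f uminus])
  then show thesis
    using that[of "{-v..-u}"] st uv by force
qed


section \<open>Almost-geodesics\<close>

lemma abs_continuous_on_imp_continuous_on:
  fixes \<sigma> :: "real \<Rightarrow> 'a::metric_space"
  assumes "abs_continuous_on {s..t} \<sigma>"
  shows "continuous_on {s..t} \<sigma>"
  unfolding continuous_on_iff
proof (intro ballI allI impI)
  fix x e :: real
  assume x: "x \<in> {s..t}" and "e > 0"
  then obtain d where "d > 0" and d: "\<forall>(n::nat) a b. (\<forall>i<n. a i \<le> b i \<and> {a i..b i} \<subseteq> {s..t}) \<and>
        (\<forall>i<n. \<forall>j<n. i \<noteq> j \<longrightarrow> {a i<..<b i} \<inter> {a j<..<b j} = {}) \<and>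
        (\<Sum>i<n. b i - a i) < d \<longrightarrow> (\<Sum>i<n. dist (\<sigma> (a i)) (\<sigma> (b i))) < e"
    using assms[unfolded abs_continuous_on_def, THEN spec, THEN mp, OF \<open>e > 0\<close>]
    by (elim exE conjE) (rule that)
  have "dist (\<sigma> y) (\<sigma> x) < e" if y: "y \<in> {s..t}" "dist y x < d" for y
  proof -
    \<comment> \<open>Absolute continuity is applied to one single interval, whose endpoints have to
      be put in order first.\<close>
    have "dist (\<sigma> (min x y)) (\<sigma> (max x y)) < e"
      using spec[OF spec[OF spec[OF d, of 1], of "\<lambda>_. min x y"], of "\<lambda>_. max x y"] x y by (auto simp: dist_real_def)
    then show ?thesis
      by (cases "x \<le> y") (auto simp: dist_commute min_def max_def)
  qed
  with \<open>d > 0\<close> show "\<exists>d>0. \<forall>y\<in>{s..t}. dist y x < d \<longrightarrow> dist (\<sigma> y) (\<sigma> x) < e"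
    by blast
qed

lemma abs_continuous_on_shift:
  assumes "abs_continuous_on I \<sigma>" "(+) s ` J \<subseteq> I"
  shows "abs_continuous_on J (\<lambda>u. \<sigma> (s + u))"
  unfolding abs_continuous_on_def
proof (intro allI impI)
  fix e :: real
  assume "e > 0"
  then obtain d where "d > 0" and d: "\<forall>(n::nat) a b. (\<forall>i<n. a i \<le> b i \<and> {a i..b i} \<subseteq> I) \<and>
        (\<forall>i<n. \<forall>j<n. i \<noteq> j \<longrightarrow> {a i<..<b i} \<inter> {a j<..<b j} = {}) \<and>
        (\<Sum>i<n. b i - a i) < d \<longrightarrow> (\<Sum>i<n. dist (\<sigma> (a i)) (\<sigma> (b i))) < e"
    using assms(1)[unfolded abs_continuous_on_def, THEN spec, THEN mp, OF \<open>e > 0\<close>]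
    by (elim exE conjE) (rule that)
  show "\<exists>d>0. \<forall>(n::nat) a b. (\<forall>i<n. a i \<le> b i \<and> {a i..b i} \<subseteq> J) \<and>
        (\<forall>i<n. \<forall>j<n. i \<noteq> j \<longrightarrow> {a i<..<b i} \<inter> {a j<..<b j} = {}) \<and>
        (\<Sum>i<n. b i - a i) < d \<longrightarrow> (\<Sum>i<n. dist (\<sigma> (s + a i)) (\<sigma> (s + b i))) < e"
  proof (rule exI[of _ d], intro conjI allI impI, rule \<open>d > 0\<close>, elim conjE)
    fix n :: nat and a b
    assume ab: "\<forall>i<n. a i \<le> b i \<and> {a i..b i} \<subseteq> J"
      and disj: "\<forall>i<n. \<forall>j<n. i \<noteq> j \<longrightarrow> {a i<..<b i} \<inter> {a j<..<b j} = {}"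
      and sm: "(\<Sum>i<n. b i - a i) < d"
    have "{s + a i..s + b i} \<subseteq> I" if "i < n" for i
    proof -
      have "(+) s ` {a i..b i} \<subseteq> I"
        by (rule order_trans[OF image_mono assms(2)]) (use ab that in blast)
      then show ?thesis
        by (simp only: image_add_atLeastAtMost add.commute)
    qed
    moreover have "{s + a i<..<s + b i} \<inter> {s + a j<..<s + b j} = {}"
      if "i < n" "j < n" "i \<noteq> j" for i j
    proof (rule ccontr)
      assume "\<not> ?thesis"
      then obtain w where "w \<in> {s + a i<..<s + b i}" "w \<in> {s + a j<..<s + b j}"
        by blast
      then have "w - s \<in> {a i<..<b i} \<inter> {a j<..<b j}"
        by auto
      then show False
        using disj that by blast
    qed
    ultimately show "(\<Sum>i<n. dist (\<sigma> (s + a i)) (\<sigma> (s + b i))) < e"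
      using spec[OF spec[OF spec[OF d, of n], of "\<lambda>i. s + a i"], of "\<lambda>i. s + b i"] ab sm by simp
  qed
qed

text \<open>Translation invariance is available for \<open>lborel\<close>; the statement passes to
  it and back because the completion has the same almost-everywhere truths.\<close>

lemma AE_lebesgue_shift:
  fixes s :: real
  assumes "AE x in lebesgue. P x"
  shows "AE x in lebesgue. P (s + x)"
proof -
  have "AE x in lborel. P x"
    using assms by (simp add: AE_completion_iff)
  then have "AE x in distr lborel borel ((+) s). P x"
    by (simp only: lborel_distr_plus)
  then have "AE x in lborel. P (s + x)"
    by (rule AE_distrD[rotated]) simp
  then show ?thesis
    by (rule AE_completion)
qed

text \<open>Visibility speaks of arcs parametrised from 0, so subarcs must be translated. The
  distance bounds depend on parameter differences only, and a derivative within \<open>I\<close>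
  restricts to one within the shifted set.\<close>

lemma almost_geodesic_shift:
  assumes ag: "almost_geodesic lam kap \<Omega> I \<sigma>" and sub: "(+) s ` J \<subseteq> I"
    and meas: "I \<in> sets lebesgue" "J \<in> sets lebesgue"
  shows "almost_geodesic lam kap \<Omega> J (\<lambda>u. \<sigma> (s + u))"
proof -
  let ?P = "\<lambda>t. \<exists>v. (\<sigma> has_vector_derivative v) (at t within I) \<and> kobayashi_metric \<Omega> (\<sigma> t) v \<le> lam"
  \<comment> \<open>For measurable sets the restricted measure turns into an implication over the
    whole line, where translation is harmless.\<close>
  have "AE t in lebesgue. t \<in> I \<longrightarrow> ?P t"
    using ag meas unfolding almost_geodesic_def by (simp add: AE_restrict_space_iff)
  then have "AE t in lebesgue. s + t \<in> I \<longrightarrow> ?P (s + t)"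
    by (rule AE_lebesgue_shift)
  moreover have "((\<lambda>u. \<sigma> (s + u)) has_vector_derivative v) (at t within J)"
    if "(\<sigma> has_vector_derivative v) (at (s + t) within I)" for t v
  proof -
    have "((+) s has_vector_derivative 1) (at t within J)"
      by (auto intro!: derivative_eq_intros)
    then show ?thesis
      using vector_diff_chain_within[of "(+) s" 1 t J \<sigma> v]
        has_vector_derivative_within_subset[OF that sub] by (simp add: o_def)
  qed
  moreover have "s + t \<in> I" if "t \<in> J" for t
    using that sub by auto
  ultimately have "AE t in lebesgue. t \<in> J \<longrightarrow>
      (\<exists>v. ((\<lambda>u. \<sigma> (s + u)) has_vector_derivative v) (at t within J) \<and>
           kobayashi_metric \<Omega> (\<sigma> (s + t)) v \<le> lam)"
    by (elim eventually_mono) blast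
  moreover have "\<bar>x - y\<bar> / lam - kap \<le> kobayashi_dist \<Omega> (\<sigma> (s + x)) (\<sigma> (s + y)) \<and>
      kobayashi_dist \<Omega> (\<sigma> (s + x)) (\<sigma> (s + y)) \<le> lam * \<bar>x - y\<bar> + kap"
    if "x \<in> J" "y \<in> J" for x y
  proof -
    have "s + x \<in> I" "s + y \<in> I"
      using that sub by auto
    then have "\<bar>(s + x) - (s + y)\<bar> / lam - kap \<le> kobayashi_dist \<Omega> (\<sigma> (s + x)) (\<sigma> (s + y)) \<and>
      kobayashi_dist \<Omega> (\<sigma> (s + x)) (\<sigma> (s + y)) \<le> lam * \<bar>(s + x) - (s + y)\<bar> + kap"
      using ag unfolding almost_geodesic_def by blast
    then show ?thesis
      by simp
  qed
  ultimately show ?thesis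
    using ag sub abs_continuous_on_shift[of I \<sigma> s J] meas
    unfolding almost_geodesic_def by (auto simp: AE_restrict_space_iff image_subset_iff)
qed

text \<open>The arc from \<open>s\<close> to \<open>t\<close>, translated to start at 0, is itself
  an almost-geodesic with endpoints near \<open>p\<close> and \<open>q\<close>; the compact set that
  it meets is also met by the whole \<open>\<sigma>\<close>.\<close>

lemma visible_pair_subarc:
  assumes "visible_pair lam kap \<Omega> K (Pt p) (Pt q)"
  obtains e C where "e > 0" "compact C" "C \<subseteq> \<Omega>"
    "\<And>T \<sigma> s t. \<lbrakk>almost_geodesic lam kap \<Omega> {0..T} \<sigma>; 0 \<le> s; s \<le> t; t \<le> T;
       dist (\<sigma> s) p < e; dist (\<sigma> t) q < e\<rbrakk> \<Longrightarrow> \<sigma> ` {0..T} \<inter> C \<noteq> {}"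
proof -
  from assms obtain V W C where V: "end_nhd \<Omega> K (Pt p) V" and W: "end_nhd \<Omega> K (Pt q) W"
    and C: "compact C" "C \<subseteq> \<Omega>"
    and hit: "\<forall>T\<ge>0. \<forall>\<sigma>. almost_geodesic lam kap \<Omega> {0..T} \<sigma> \<and> Pt (\<sigma> 0) \<in> V \<and> Pt (\<sigma> T) \<in> W
      \<longrightarrow> \<sigma> ` {0..T} \<inter> C \<noteq> {}"
    unfolding visible_pair_def by (elim exE conjE) (rule that)
  obtain e1 where e1: "e1 > 0" "Pt ` (ball p e1 \<inter> closure \<Omega>) \<subseteq> V"
    using V unfolding end_nhd_def by auto
  obtain e2 where e2: "e2 > 0" "Pt ` (ball q e2 \<inter> closure \<Omega>) \<subseteq> W"
    using W unfolding end_nhd_def by auto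
  show thesis
  proof (rule that[of "min e1 e2" C])
    fix T s t :: real and \<sigma>
    assume ag: "almost_geodesic lam kap \<Omega> {0..T} \<sigma>" and st: "0 \<le> s" "s \<le> t" "t \<le> T"
      and ds: "dist (\<sigma> s) p < min e1 e2" and dt: "dist (\<sigma> t) q < min e1 e2"
    have "\<sigma> ` {0..T} \<subseteq> closure \<Omega>"
      using ag closure_subset unfolding almost_geodesic_def by blast
    then have "\<sigma> s \<in> closure \<Omega>" "\<sigma> t \<in> closure \<Omega>"
      using st by auto
    then have "Pt (\<sigma> s) \<in> V" "Pt (\<sigma> t) \<in> W"
      using e1 e2 ds dt by (auto simp: dist_commute)
    moreover have sub: "(+) s ` {0..t - s} \<subseteq> {0..T}"
      using st by auto
    have "almost_geodesic lam kap \<Omega> {0..t - s} (\<lambda>u. \<sigma> (s + u))"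
      by (rule almost_geodesic_shift[OF ag sub]) auto
    ultimately have "(\<lambda>u. \<sigma> (s + u)) ` {0..t - s} \<inter> C \<noteq> {}"
      using hit[rule_format, of "t - s" "\<lambda>u. \<sigma> (s + u)"] st by simp
    moreover have "(\<lambda>u. \<sigma> (s + u)) ` {0..t - s} \<subseteq> \<sigma> ` {0..T}"
      using sub by auto
    ultimately show "\<sigma> ` {0..T} \<inter> C \<noteq> {}"
      by blast
  qed (use e1 e2 C in auto)
qed

section \<open>Almost-geodesics across a shell meet one compact set\<close>

lemma visibility_traps_crossing_geodesics:
  fixes \<Omega> S :: "(complex ^ 'n) set"
  assumes "open \<Omega>" "totally_disconnected S" "r < R"
    and vis: "\<And>x y. \<lbrakk>x \<in> frontier \<Omega> - S; y \<in> frontier \<Omega> - S; x \<noteq> y\<rbrakk>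
           \<Longrightarrow> visible_pair lam kap \<Omega> K (Pt x) (Pt y)"
  shows "\<exists>C. compact C \<and> C \<subseteq> \<Omega> \<and>
    (\<forall>T \<sigma>. almost_geodesic lam kap \<Omega> {0..T} \<sigma> \<and> (\<exists>s\<in>{0..T}. dist c (\<sigma> s) \<le> r) \<and>
       (\<exists>t\<in>{0..T}. R \<le> dist c (\<sigma> t)) \<longrightarrow> \<sigma> ` {0..T} \<inter> C \<noteq> {})"
proof (rule ccontr)
  assume neg: "\<not> ?thesis"
  \<comment> \<open>Every compact subset of \<open>\<Omega>\<close> lies in all late
    \<open>C n\<close>, so almost-geodesics missing \<open>C n\<close> eventually leave each such
    subset.\<close>
  obtain C :: "nat \<Rightarrow> (complex ^ 'n) set"
    where C: "\<And>n. compact (C n)" "\<And>n. C n \<subseteq> \<Omega>"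
      and Cex: "\<And>D. \<lbrakk>compact D; D \<subseteq> \<Omega>\<rbrakk> \<Longrightarrow> \<exists>N. \<forall>n\<ge>N. D \<subseteq> C n"
    using open_Union_compact_subsets[OF \<open>open \<Omega>\<close>] by metis
  have "\<exists>T \<sigma> s t. almost_geodesic lam kap \<Omega> {0..T} \<sigma> \<and> s \<in> {0..T} \<and> t \<in> {0..T} \<and>
       dist c (\<sigma> s) \<le> r \<and> R \<le> dist c (\<sigma> t) \<and> \<sigma> ` {0..T} \<inter> C n = {}" for n
    using neg C[of n] by metis
  then obtain T \<sigma> s t where ag: "\<And>n. almost_geodesic lam kap \<Omega> {0..T n} (\<sigma> n)"
    and st: "\<And>n. s n \<in> {0..T n}" "\<And>n. t n \<in> {0..T n}"
      "\<And>n. dist c (\<sigma> n (s n)) \<le> r" "\<And>n. R \<le> dist c (\<sigma> n (t n))"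
    and miss: "\<And>n. \<sigma> n ` {0..T n} \<inter> C n = {}"
    by metis
  have \<sigma>\<Omega>: "\<sigma> n ` {0..T n} \<subseteq> \<Omega>" for n
    using ag unfolding almost_geodesic_def by blast
  have cont: "continuous_on {0..T n} (\<sigma> n)" for n
    using ag abs_continuous_on_imp_continuous_on unfolding almost_geodesic_def by blast
  have arcs: "\<exists>J. connected J \<and> J \<subseteq> {0..T n} \<and> a \<in> dist c ` \<sigma> n ` J \<and> b \<in> dist c ` \<sigma> n ` J \<and>
      dist c ` \<sigma> n ` J \<subseteq> {a..b}" if ab: "r \<le> a" "a < b" "b \<le> R" for a b n
  proof -
    have f: "continuous_on {0..T n} (\<lambda>x. dist c (\<sigma> n x))"
      by (intro continuous_intros cont)
    have "dist c (\<sigma> n (s n)) \<le> a" "b \<le> dist c (\<sigma> n (t n))"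
      using st[of n] ab by linarith+
    then obtain J where "connected J" "J \<subseteq> {0..T n}" "a \<in> (\<lambda>x. dist c (\<sigma> n x)) ` J"
        "b \<in> (\<lambda>x. dist c (\<sigma> n x)) ` J" "(\<lambda>x. dist c (\<sigma> n x)) ` J \<subseteq> {a..b}"
      using crossing_connected[OF f st(1,2) _ ab(2)] by metis
    then show ?thesis
      unfolding image_image by blast
  qed
  \<comment> \<open>The reindexing \<open>k\<close> is built in because the second limit is taken
    along the indices that the first one produces.\<close>
  have avoid: "\<forall>\<^sub>F n in sequentially. \<sigma> (k n) ` J (k n) \<inter> D = {}"
    if D: "compact D" "D \<subseteq> \<Omega>" and k: "\<And>n. n \<le> k n" and J: "\<And>n. J n \<subseteq> {0..T n}"
    for D J and k :: "nat \<Rightarrow> nat"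
  proof -
    obtain N where N: "\<And>n. n \<ge> N \<Longrightarrow> D \<subseteq> C n"
      using Cex[OF D] by blast
    have "\<sigma> (k n) ` J (k n) \<inter> D = {}" if "n \<ge> N" for n
      using N[of "k n"] k[of n] that miss[of "k n"] J[of "k n"] by force
    then show ?thesis
      unfolding eventually_sequentially by blast
  qed
  \<comment> \<open>The inner and outer thirds of the shell carry the two limit points; the middle
    third keeps them apart.\<close>
  define d where "d = (R - r) / 3"
  have d: "d > 0" "R = r + 3 * d"
    using \<open>r < R\<close> by (auto simp: d_def diff_divide_distrib)
  have "\<forall>n. \<exists>J. connected J \<and> J \<subseteq> {0..T n} \<and> r \<in> dist c ` \<sigma> n ` J \<and>
      r + d \<in> dist c ` \<sigma> n ` J \<and> dist c ` \<sigma> n ` J \<subseteq> {r..r + d}"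
    using arcs[of r "r + d"] d by simp
  then obtain J1 where J1: "\<And>n. connected (J1 n)" "\<And>n. J1 n \<subseteq> {0..T n}"
    "\<And>n. r \<in> dist c ` \<sigma> n ` J1 n" "\<And>n. r + d \<in> dist c ` \<sigma> n ` J1 n"
    "\<And>n. dist c ` \<sigma> n ` J1 n \<subseteq> {r..r + d}"
    by metis
  have "\<forall>n. \<exists>J. connected J \<and> J \<subseteq> {0..T n} \<and> r + 2 * d \<in> dist c ` \<sigma> n ` J \<and>
      R \<in> dist c ` \<sigma> n ` J \<and> dist c ` \<sigma> n ` J \<subseteq> {r + 2 * d..R}"
    using arcs[of "r + 2 * d" R] d by simp
  then obtain J2 where J2: "\<And>n. connected (J2 n)" "\<And>n. J2 n \<subseteq> {0..T n}"
    "\<And>n. r + 2 * d \<in> dist c ` \<sigma> n ` J2 n" "\<And>n. R \<in> dist c ` \<sigma> n ` J2 n"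
    "\<And>n. dist c ` \<sigma> n ` J2 n \<subseteq> {r + 2 * d..R}"
    by metis
  have conn: "connected (\<sigma> n ` J1 n)" "connected (\<sigma> n ` J2 n)" for n
    by (intro connected_continuous_image continuous_on_subset[OF cont] J1 J2)+
  have sub: "\<sigma> n ` J1 n \<subseteq> \<Omega>" "\<sigma> n ` J2 n \<subseteq> \<Omega>" for n
    using \<sigma>\<Omega>[of n] J1(2)[of n] J2(2)[of n] by blast+
  have lt: "r < r + d" "r + 2 * d < R"
    using d by simp_all
  have avoid1: "\<forall>\<^sub>F n in sequentially. \<sigma> n ` J1 n \<inter> D = {}" if "compact D" "D \<subseteq> \<Omega>" for D
    by (rule avoid[OF that, where k="\<lambda>n. n"]) (simp_all add: J1(2))
  obtain p z k where p: "p \<in> frontier \<Omega> - S" "dist c p \<in> {r..r + d}"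
    and k: "\<And>n. n \<le> k n" and z: "\<And>n. z n \<in> \<sigma> (k n) ` J1 (k n)" "z \<longlonglongrightarrow> p"
    by (rule crossing_sequence_limit[OF assms(2) lt(1), where B="\<lambda>n. \<sigma> n ` J1 n",
        OF conn(1) sub(1) J1(5,3,4) _ \<open>open \<Omega>\<close>], rule avoid1, assumption+, rule that)
  have avoid2: "\<forall>\<^sub>F n in sequentially. \<sigma> (k n) ` J2 (k n) \<inter> D = {}" if "compact D" "D \<subseteq> \<Omega>" for D
    by (rule avoid[OF that k]) (simp add: J2(2))
  \<comment> \<open>Running along \<open>k\<close>, this limit uses points \<open>y n\<close> on the
    curve with index \<open>k (m n)\<close>, which also carries \<open>z (m n)\<close>.\<close>
  obtain q y m where q: "q \<in> frontier \<Omega> - S" "dist c q \<in> {r + 2 * d..R}"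
    and m: "\<And>n. n \<le> m n" and y: "\<And>n. y n \<in> \<sigma> (k (m n)) ` J2 (k (m n))" "y \<longlonglongrightarrow> q"
    by (rule crossing_sequence_limit[OF assms(2) lt(2), where B="\<lambda>n. \<sigma> (k n) ` J2 (k n)",
        OF conn(2) sub(2) J2(5,3,4) _ \<open>open \<Omega>\<close>], rule avoid2, assumption+, rule that)
  have "p \<noteq> q"
    using p(2) q(2) d by auto
  obtain e1 C1 where e1: "e1 > 0" and C1: "compact C1" "C1 \<subseteq> \<Omega>"
    and hit1: "\<And>T \<sigma> s t. \<lbrakk>almost_geodesic lam kap \<Omega> {0..T} \<sigma>; 0 \<le> s; s \<le> t; t \<le> T;
       dist (\<sigma> s) p < e1; dist (\<sigma> t) q < e1\<rbrakk> \<Longrightarrow> \<sigma> ` {0..T} \<inter> C1 \<noteq> {}"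
    using visible_pair_subarc[OF vis[OF p(1) q(1) \<open>p \<noteq> q\<close>]] by metis
  \<comment> \<open>Visibility is used in both orders, since the curve may come close to
    \<open>q\<close> before it comes close to \<open>p\<close>.\<close>
  obtain e2 C2 where e2: "e2 > 0" and C2: "compact C2" "C2 \<subseteq> \<Omega>"
    and hit2: "\<And>T \<sigma> s t. \<lbrakk>almost_geodesic lam kap \<Omega> {0..T} \<sigma>; 0 \<le> s; s \<le> t; t \<le> T;
       dist (\<sigma> s) q < e2; dist (\<sigma> t) p < e2\<rbrakk> \<Longrightarrow> \<sigma> ` {0..T} \<inter> C2 \<noteq> {}"
    using visible_pair_subarc[OF vis[OF q(1) p(1) \<open>p \<noteq> q\<close>[symmetric]]] by metis
  define e where "e = min e1 e2"
  have "e > 0"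
    using e1 e2 by (simp add: e_def)
  obtain N where N: "\<And>n. n \<ge> N \<Longrightarrow> C1 \<union> C2 \<subseteq> C n"
    using Cex[of "C1 \<union> C2"] C1 C2 by auto
  obtain M1 where M1: "\<And>n. n \<ge> M1 \<Longrightarrow> dist (z n) p < e"
    using metric_LIMSEQ_D[OF z(2) \<open>e > 0\<close>] by blast
  obtain M2 where M2: "\<And>n. n \<ge> M2 \<Longrightarrow> dist (y n) q < e"
    using metric_LIMSEQ_D[OF y(2) \<open>e > 0\<close>] by blast
  \<comment> \<open>One choice serves all three bounds, because
    \<open>n \<le> m n \<le> k (m n)\<close>.\<close>
  define n where "n = max N (max M1 M2)"
  define i where "i = k (m n)"
  have ge: "N \<le> i" "M1 \<le> m n" "M2 \<le> n"
    using m[of n] k[of "m n"] by (auto simp: n_def i_def)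
  obtain u where u: "u \<in> {0..T i}" "z (m n) = \<sigma> i u"
    using z(1)[of "m n"] J1(2)[of i] unfolding i_def by blast
  obtain v where v: "v \<in> {0..T i}" "y n = \<sigma> i v"
    using y(1)[of n] J2(2)[of i] unfolding i_def by blast
  have close: "dist (\<sigma> i u) p < e1" "dist (\<sigma> i u) p < e2" "dist (\<sigma> i v) q < e1" "dist (\<sigma> i v) q < e2"
    using M1[OF ge(2)] M2[OF ge(3)] u v by (auto simp: e_def)
  have "\<sigma> i ` {0..T i} \<inter> (C1 \<union> C2) \<noteq> {}"
  proof (cases "u \<le> v")
    case True
    then show ?thesis
      using hit1[OF ag[of i], of u v] u v close by auto
  next
    case False
    then show ?thesis
      using hit2[OF ag[of i], of v u] u v close by auto
  qed
  then show False
    using N[OF ge(1)] miss[of i] by blast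
qed


section \<open>Separation in the end compactification\<close>

lemma exhaustion_mono:
  assumes "exhaustion X K" "i \<le> j"
  shows "K i \<subseteq> K j"
proof (rule lift_Suc_mono_le[OF _ assms(2)])
  show "K n \<subseteq> K (Suc n)" for n
    using assms(1) interior_of_subset[of "top_of_set X" "K (Suc n)"]
    unfolding exhaustion_def by (meson order_trans)
qed

text \<open>The relative interiors of the \<open>K (Suc j)\<close> cover \<open>X\<close>, so
  finitely many of them cover \<open>C\<close>. The lower bound \<open>i\<close> lets the index be
  chosen beyond a level already fixed.\<close>

lemma exhaustion_absorbs_compact:
  assumes X: "exhaustion X K" and C: "compact C" "C \<subseteq> X"
  obtains j where "i \<le> j" "C \<subseteq> K j"
proof -
  have "\<exists>U. open U \<and> top_of_set X interior_of K (Suc j) = X \<inter> U" for j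
    using openin_interior_of[of "top_of_set X" "K (Suc j)"] unfolding openin_open by blast
  then obtain U where U: "\<And>j. open (U j)" "\<And>j. top_of_set X interior_of K (Suc j) = X \<inter> U j"
    by metis
  have UK: "X \<inter> U j \<subseteq> K (Suc j)" for j
    using U(2)[of j] interior_of_subset[of "top_of_set X" "K (Suc j)"] by blast
  have "C \<subseteq> (\<Union>j. U j)"
  proof
    fix x assume "x \<in> C"
    then obtain j where "x \<in> K j"
      using C(2) X unfolding exhaustion_def by blast
    then show "x \<in> (\<Union>j. U j)"
      using X U(2)[of j] unfolding exhaustion_def by blast
  qed
  then obtain I where I: "finite I" "C \<subseteq> (\<Union>j\<in>I. U j)"
    using compactE_image[OF C(1), of UNIV U] U(1) by (metis UNIV_I subset_UNIV)
  \<comment> \<open>Inserting 0 keeps the maximum meaningful for empty \<open>I\<close>; the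
    successor appears since \<open>U j\<close> is controlled by \<open>K (Suc j)\<close>.\<close>
  define m where "m = max i (Suc (Max (insert 0 I)))"
  have "C \<subseteq> K m"
  proof
    fix x assume "x \<in> C"
    then obtain j where j: "j \<in> I" "x \<in> U j"
      using I by blast
    then have "x \<in> K (Suc j)"
      using UK[of j] \<open>x \<in> C\<close> C(2) by blast
    moreover have "j \<le> Max (insert 0 I)"
      using j I by (intro Max_ge) auto
    then have "Suc j \<le> m"
      by (simp add: m_def)
    ultimately show "x \<in> K m"
      using exhaustion_mono[OF X] by blast
  qed
  then show thesis
    by (rule that[rotated]) (simp add: m_def)
qed

lemma ends_component: "F \<in> ends X K \<Longrightarrow> F j \<in> components (X - K j)"
  by (simp add: ends_def)

lemma ends_disjoint: "F \<in> ends X K \<Longrightarrow> F j \<inter> K j = {}"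
  using ends_component in_components_subset by blast

lemma ends_nonempty: "F \<in> ends X K \<Longrightarrow> F j \<noteq> {}"
  using ends_component in_components_nonempty by blast

lemma ends_antimono:
  assumes "F \<in> ends X K" "i \<le> j"
  shows "F j \<subseteq> F i"
  by (rule lift_Suc_antimono_le[OF _ assms(2)]) (use assms(1) in \<open>simp add: ends_def\<close>)

text \<open>Ends decrease, so a common point at level \<open>j\<close> persists at level
  \<open>i\<close>, and components of one set that meet coincide.\<close>

lemma ends_eqI:
  assumes "F \<in> ends X K" "G \<in> ends X K" "F j \<inter> G j \<noteq> {}" "i \<le> j"
  shows "F i = G i"
proof -
  have "F i \<inter> G i \<noteq> {}"
    using assms ends_antimono[OF assms(1,4)] ends_antimono[OF assms(2,4)] by blast
  then show ?thesis
    using components_eq ends_component assms(1,2) by metis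
qed

section \<open>Closures of the basic neighbourhoods\<close>

text \<open>A component is closed relative to \<open>closure \<Omega> - K i\<close> only, so limit
  points in \<open>K i\<close> must be excluded separately. Each point of \<open>K i\<close> is
  interior to \<open>K (Suc i)\<close> and thus has a neighbourhood disjoint from
  \<open>F (Suc i)\<close>.\<close>

lemma Pt_mem_end_closure_hat:
  assumes X: "exhaustion (closure \<Omega>) K" and F: "F \<in> ends (closure \<Omega>) K"
    and z: "Pt z \<in> end_closure \<Omega> K (end_hat \<Omega> K F (Suc i))"
  shows "z \<in> F i"
proof -
  have zX: "z \<in> closure \<Omega>"
    using z by (auto simp: end_closure_def end_compactification_def split: if_splits)
  have near: "ball z e \<inter> closure \<Omega> \<inter> F (Suc i) \<noteq> {}" if "e > 0" for e
  proof -
    have "end_nhd \<Omega> K (Pt z) (Pt ` (ball z e \<inter> closure \<Omega>))"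
      using that by (auto simp: end_nhd_def end_compactification_def)
    then have "Pt ` (ball z e \<inter> closure \<Omega>) \<inter> end_hat \<Omega> K F (Suc i) \<noteq> {}"
      using z unfolding end_closure_def by blast
    then show ?thesis
      unfolding end_hat_def by auto
  qed
  have "z \<notin> K i"
  proof
    assume "z \<in> K i"
    then have "z \<in> top_of_set (closure \<Omega>) interior_of K (Suc i)"
      using X unfolding exhaustion_def by blast
    moreover obtain U where U: "open U" "top_of_set (closure \<Omega>) interior_of K (Suc i) = closure \<Omega> \<inter> U"
      using openin_interior_of[of "top_of_set (closure \<Omega>)" "K (Suc i)"] unfolding openin_open by blast
    ultimately obtain e where "e > 0" "ball z e \<subseteq> U"
      using open_contains_ball by blast
    then have "ball z e \<inter> closure \<Omega> \<subseteq> K (Suc i)"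
      using U(2) interior_of_subset[of "top_of_set (closure \<Omega>)" "K (Suc i)"] by blast
    then show False
      using near[OF \<open>e > 0\<close>] ends_disjoint[OF F, of "Suc i"] by blast
  qed
  have "z \<in> closure (F i)"
    unfolding closure_approachable
  proof (intro allI impI)
    fix e :: real assume "e > 0"
    then show "\<exists>y\<in>F i. dist y z < e"
      using near[of e] ends_antimono[OF F, of i "Suc i"] by (fastforce simp: dist_commute)
  qed
  moreover obtain D where "closed D" "F i = (closure \<Omega> - K i) \<inter> D"
    using closedin_component[OF ends_component[OF F, of i]] unfolding closedin_closed by blast
  ultimately show ?thesis
    using zX \<open>z \<notin> K i\<close> closure_minimal[of "F i" D] by blast
qed

lemma End_mem_end_closure_hat:
  assumes F: "F \<in> ends (closure \<Omega>) K"
    and H: "End H \<in> end_closure \<Omega> K (end_hat \<Omega> K F j)" and "i \<le> j"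
  shows "H i = F i"
proof -
  have unb: "\<not> bounded \<Omega>" and HE: "H \<in> ends (closure \<Omega>) K"
    using H by (auto simp: end_closure_def end_compactification_def split: if_splits)
  have "end_nhd \<Omega> K (End H) (end_hat \<Omega> K H j)"
    using unb in_components_subset[OF ends_component[OF HE, of j]]
    by (auto simp: end_nhd_def end_compactification_def end_hat_def)
  then have "end_hat \<Omega> K H j \<inter> end_hat \<Omega> K F j \<noteq> {}"
    using H unfolding end_closure_def by blast
  \<comment> \<open>A common finite point lies in both components. A common end agrees with
    \<open>H\<close> and with \<open>F\<close> at level \<open>j\<close>, which makes these nonempty
    components equal.\<close>
  then have "H j \<inter> F j \<noteq> {}"
    unfolding end_hat_def using ends_nonempty[OF F, of j] by auto
  then show ?thesis
    using ends_eqI[OF HE F _ \<open>i \<le> j\<close>] by blast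
qed

text \<open>No end adheres to a bounded set: the closed ball meets \<open>closure \<Omega>\<close>
  in a compact set, which some \<open>K j\<close> swallows, and the neighbourhood of level
  \<open>j\<close> of any end misses \<open>K j\<close>.\<close>

lemma end_closure_ball:
  assumes X: "exhaustion (closure \<Omega>) K"
    and \<xi>: "\<xi> \<in> end_closure \<Omega> K (Pt ` (ball x e \<inter> closure \<Omega>))"
  obtains z where "\<xi> = Pt z" "z \<in> closure \<Omega>" "dist x z \<le> e"
proof (cases \<xi>)
  case (Pt z)
  have zX: "z \<in> closure \<Omega>"
    using \<xi> Pt by (auto simp: end_closure_def end_compactification_def split: if_splits)
  have "z \<in> closure (ball x e)"
    unfolding closure_approachable
  proof (intro allI impI)
    fix d :: real assume "d > 0"
    then have "end_nhd \<Omega> K (Pt z) (Pt ` (ball z d \<inter> closure \<Omega>))"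
      by (auto simp: end_nhd_def end_compactification_def)
    then have "Pt ` (ball z d \<inter> closure \<Omega>) \<inter> Pt ` (ball x e \<inter> closure \<Omega>) \<noteq> {}"
      using \<xi> Pt unfolding end_closure_def by blast
    then show "\<exists>y\<in>ball x e. dist y z < d"
      by (auto simp: dist_commute)
  qed
  then have "dist x z \<le> e"
    using closure_minimal[OF ball_subset_cball closed_cball] by fastforce
  then show thesis
    using that Pt zX by blast
next
  case (End H)
  have unb: "\<not> bounded \<Omega>" and HE: "H \<in> ends (closure \<Omega>) K"
    using \<xi> End by (auto simp: end_closure_def end_compactification_def split: if_splits)
  have "compact (cball x e \<inter> closure \<Omega>)"
    by (simp add: compact_Int_closed)
  then obtain j where j: "cball x e \<inter> closure \<Omega> \<subseteq> K j"
    using exhaustion_absorbs_compact[OF X, of "cball x e \<inter> closure \<Omega>" 0] by auto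
  have "end_nhd \<Omega> K (End H) (end_hat \<Omega> K H j)"
    using unb in_components_subset[OF ends_component[OF HE, of j]]
    by (auto simp: end_nhd_def end_compactification_def end_hat_def)
  then have "end_hat \<Omega> K H j \<inter> Pt ` (ball x e \<inter> closure \<Omega>) \<noteq> {}"
    using \<xi> End unfolding end_closure_def by blast
  then obtain y where "y \<in> H j" "y \<in> ball x e \<inter> closure \<Omega>"
    unfolding end_hat_def by blast
  then have False
    using j ends_disjoint[OF HE, of j] ball_subset_cball[of x e] by blast
  then show thesis ..
qed

section \<open>Separating points and ends by spherical shells\<close>

text \<open>This isolates the purely topological half of visibility: almost-geodesics will enter
  only through their connected images. Which neighbourhood lies on the inner side is left open,
  which makes the notion symmetric and also allows both to lie outside, as for two ends.\<close>

definition crossing_separation ::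
  "'a::euclidean_space set \<Rightarrow> (nat \<Rightarrow> 'a set) \<Rightarrow> 'a end_point \<Rightarrow> 'a end_point \<Rightarrow> bool" where
  "crossing_separation \<Omega> K \<zeta> \<eta> \<longleftrightarrow>
     (\<exists>V W c r R. end_nhd \<Omega> K \<zeta> V \<and> end_nhd \<Omega> K \<eta> W \<and>
        end_closure \<Omega> K V \<inter> end_closure \<Omega> K W = {} \<and> r < R \<and>
        (\<forall>B\<subseteq>\<Omega>. connected B \<and> Pt ` B \<inter> V \<noteq> {} \<and> Pt ` B \<inter> W \<noteq> {} \<longrightarrow>
           (\<exists>x\<in>B. dist c x \<le> r) \<and> (\<exists>x\<in>B. R \<le> dist c x)))"

lemma crossing_separationI:
  assumes "end_nhd \<Omega> K \<zeta> V" "end_nhd \<Omega> K \<eta> W"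
    and "end_closure \<Omega> K V \<inter> end_closure \<Omega> K W = {}" "r < R"
    and "\<And>B. \<lbrakk>B \<subseteq> \<Omega>; connected B; Pt ` B \<inter> V \<noteq> {}; Pt ` B \<inter> W \<noteq> {}\<rbrakk>
      \<Longrightarrow> (\<exists>x\<in>B. dist c x \<le> r) \<and> (\<exists>x\<in>B. R \<le> dist c x)"
  shows "crossing_separation \<Omega> K \<zeta> \<eta>"
  unfolding crossing_separation_def
proof (rule exI[of _ V], rule exI[of _ W], rule exI[of _ c], rule exI[of _ r], rule exI[of _ R],
    intro conjI assms(1-4) allI impI)
  fix B
  assume "B \<subseteq> \<Omega>" and "connected B \<and> Pt ` B \<inter> V \<noteq> {} \<and> Pt ` B \<inter> W \<noteq> {}"
  then show "\<exists>x\<in>B. dist c x \<le> r" "\<exists>x\<in>B. R \<le> dist c x"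
    using assms(5)[of B] by simp_all
qed

lemma crossing_separation_sym:
  "crossing_separation \<Omega> K \<zeta> \<eta> \<Longrightarrow> crossing_separation \<Omega> K \<eta> \<zeta>"
  unfolding crossing_separation_def
  apply (elim exE)
  subgoal for V W c r R
    by (intro exI[of _ W] exI[of _ V] exI[of _ c] exI[of _ r] exI[of _ R])
      (simp add: Int_commute conj_ac)
  done

lemma crossing_separation_Pt_Pt:
  assumes X: "exhaustion (closure \<Omega>) K" and "x \<noteq> y"
  shows "crossing_separation \<Omega> K (Pt x) (Pt y)"
proof -
  \<comment> \<open>With centre \<open>x\<close>, the first neighbourhood stays within distance
    \<open>e\<close> and the second beyond \<open>2 * e\<close>.\<close>
  define e where "e = dist x y / 3"
  have e: "e > 0" "dist x y = 3 * e"
    using \<open>x \<noteq> y\<close> by (simp_all add: e_def)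
  let ?V = "\<lambda>x. Pt ` (ball x e \<inter> closure \<Omega>)"
  have far: "2 * e \<le> dist x z" if "dist y z \<le> e" for z
    using that e(2) dist_triangle2[of x y z] by simp
  have "end_closure \<Omega> K (?V x) \<inter> end_closure \<Omega> K (?V y) = {}"
  proof (rule ccontr)
    assume "\<not> ?thesis"
    then obtain \<xi> where "\<xi> \<in> end_closure \<Omega> K (?V x)" "\<xi> \<in> end_closure \<Omega> K (?V y)"
      by blast
    then obtain z where "dist x z \<le> e" "dist y z \<le> e"
      using end_closure_ball[OF X] by (metis end_point.inject(1))
    then show False
      using far[of z] e(1) by simp
  qed
  moreover have "end_nhd \<Omega> K (Pt z) (?V z)" for z
    using e(1) by (auto simp: end_nhd_def end_compactification_def)
  moreover have "(\<exists>z\<in>B. dist x z \<le> e) \<and> (\<exists>z\<in>B. 2 * e \<le> dist x z)"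
    if B: "Pt ` B \<inter> ?V x \<noteq> {}" "Pt ` B \<inter> ?V y \<noteq> {}" for B
  proof -
    obtain u where "u \<in> B" "dist x u < e"
      using B(1) by auto
    moreover obtain v where "v \<in> B" "dist y v < e"
      using B(2) by auto
    ultimately show ?thesis
      using far[of v] by (meson less_imp_le)
  qed
  moreover have "e < 2 * e"
    using e(1) by simp
  ultimately show ?thesis
    by (intro crossing_separationI[where V="?V x" and W="?V y" and r=e and R="2 * e" and c=x])
qed

text \<open>The neighbourhoods are indexed one step beyond the radius considered because the component
  \<open>F i\<close> need not contain the closure of \<open>F i\<close>, whereas it does contain the closure of \<open>F (Suc i)\<close>.\<close>

lemma crossing_separation_Pt_End:
  assumes X: "exhaustion (closure \<Omega>) K" and F: "F \<in> ends (closure \<Omega>) K" and unb: "\<not> bounded \<Omega>"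
  shows "crossing_separation \<Omega> K (Pt x) (End F)"
proof -
  \<comment> \<open>Radius 2 is arbitrary: it only has to exceed the radius 1 of the neighbourhood
    of \<open>x\<close>, so that a shell fits between.\<close>
  have "compact (cball x 2 \<inter> closure \<Omega>)"
    by (simp add: compact_Int_closed)
  then obtain j where j: "cball x 2 \<inter> closure \<Omega> \<subseteq> K j"
    using exhaustion_absorbs_compact[OF X, of "cball x 2 \<inter> closure \<Omega>" 0] by auto
  let ?V = "Pt ` (ball x 1 \<inter> closure \<Omega>)" and ?W = "end_hat \<Omega> K F (Suc j)"
  have far: "2 < dist x z" if "z \<in> F j" for z
    using that j ends_disjoint[OF F, of j] in_components_subset[OF ends_component[OF F, of j]]
    by force
  have "end_closure \<Omega> K ?V \<inter> end_closure \<Omega> K ?W = {}"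
  proof (rule ccontr)
    assume "\<not> ?thesis"
    then obtain \<xi> where \<xi>: "\<xi> \<in> end_closure \<Omega> K ?V" "\<xi> \<in> end_closure \<Omega> K ?W"
      by blast
    obtain z where z: "\<xi> = Pt z" "dist x z \<le> 1"
      using end_closure_ball[OF X \<xi>(1)] by metis
    then show False
      using Pt_mem_end_closure_hat[OF X F, of z j] \<xi>(2) far[of z] by simp
  qed
  moreover have "end_nhd \<Omega> K (Pt x) ?V"
    by (auto simp: end_nhd_def end_compactification_def intro: exI[of _ 1])
  moreover have "end_nhd \<Omega> K (End F) ?W"
    using unb in_components_subset[OF ends_component[OF F, of "Suc j"]]
    by (auto simp: end_nhd_def end_compactification_def end_hat_def)
  moreover have "(\<exists>z\<in>B. dist x z \<le> 1) \<and> (\<exists>z\<in>B. 2 \<le> dist x z)"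
    if B: "Pt ` B \<inter> ?V \<noteq> {}" "Pt ` B \<inter> ?W \<noteq> {}" for B
  proof
    obtain y where "y \<in> B" "dist x y < 1"
      using B(1) by auto
    then show "\<exists>z\<in>B. dist x z \<le> 1"
      by (meson less_imp_le)
    obtain z where "z \<in> B" "z \<in> F (Suc j)"
      using B(2) by (auto simp: end_hat_def)
    then show "\<exists>z\<in>B. 2 \<le> dist x z"
      using far[of z] ends_antimono[OF F, of j "Suc j"] by force
  qed
  ultimately show ?thesis
    by (intro crossing_separationI[where V="?V" and W="?W" and r=1 and R=2 and c=x]) simp_all
qed

text \<open>Both ends lie far out, so the inner crossing cannot come from the endpoints. It comes
  from \<open>K i\<close>, which separates the ends and lies within distance \<open>r\<close> of the
  origin.\<close>

lemma crossing_separation_End_End: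
  assumes X: "exhaustion (closure \<Omega>) K" and F: "F \<in> ends (closure \<Omega>) K"
    and G: "G \<in> ends (closure \<Omega>) K" and unb: "\<not> bounded \<Omega>" and "F \<noteq> G"
  shows "crossing_separation \<Omega> K (End F) (End G)"
proof -
  obtain i where i: "F i \<noteq> G i"
    using \<open>F \<noteq> G\<close> by blast
  have "bounded (K i)"
    using X compact_imp_bounded unfolding exhaustion_def by blast
  then obtain r where r: "\<And>z. z \<in> K i \<Longrightarrow> dist 0 z \<le> r"
    unfolding bounded_iff by auto
  have "compact (cball 0 (r + 1) \<inter> closure \<Omega>)"
    by (simp add: compact_Int_closed)
  \<comment> \<open>Past level \<open>m\<close> the end components lie beyond radius
    \<open>r + 1\<close>, which gives the outer crossing, and \<open>i \<le> m\<close> keeps them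
    disjoint.\<close>
  then obtain m where m: "i \<le> m" "cball 0 (r + 1) \<inter> closure \<Omega> \<subseteq> K m"
    using exhaustion_absorbs_compact[OF X, of "cball 0 (r + 1) \<inter> closure \<Omega>" i] by auto
  let ?V = "end_hat \<Omega> K F (Suc m)" and ?W = "end_hat \<Omega> K G (Suc m)"
  have disj: "F j \<inter> G j = {}" if "i \<le> j" for j
    using ends_eqI[OF F G _ that] i by blast
  have "end_closure \<Omega> K ?V \<inter> end_closure \<Omega> K ?W = {}"
  proof (rule ccontr)
    assume "\<not> ?thesis"
    then obtain \<xi> where \<xi>: "\<xi> \<in> end_closure \<Omega> K ?V" "\<xi> \<in> end_closure \<Omega> K ?W"
      by blast
    show False
    proof (cases \<xi>)
      case (Pt z)
      then show False
        using Pt_mem_end_closure_hat[OF X F, of z m] Pt_mem_end_closure_hat[OF X G, of z m] \<xi>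
          disj[OF m(1)] by auto
    next
      case (End H)
      then have "H i = F i" "H i = G i"
        using End_mem_end_closure_hat[OF F, of H "Suc m" i] End_mem_end_closure_hat[OF G, of H "Suc m" i]
          \<xi> m(1) by auto
      then show False
        using i by simp
    qed
  qed
  moreover have "end_nhd \<Omega> K (End E) (end_hat \<Omega> K E (Suc m))" if "E \<in> ends (closure \<Omega>) K" for E
    using unb in_components_subset[OF ends_component[OF that, of "Suc m"]]
    by (auto simp: end_nhd_def end_compactification_def end_hat_def)
  moreover have "(\<exists>z\<in>B. dist 0 z \<le> r) \<and> (\<exists>z\<in>B. r + 1 \<le> dist 0 z)"
    if B: "B \<subseteq> \<Omega>" "connected B" "Pt ` B \<inter> ?V \<noteq> {}" "Pt ` B \<inter> ?W \<noteq> {}" for B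
  proof -
    obtain f where f: "f \<in> B" "f \<in> F (Suc m)"
      using B(3) by (auto simp: end_hat_def)
    obtain g where g: "g \<in> B" "g \<in> G (Suc m)"
      using B(4) by (auto simp: end_hat_def)
    have fg: "f \<in> F i" "g \<in> G i"
      using f g m(1) ends_antimono[OF F, of i "Suc m"] ends_antimono[OF G, of i "Suc m"] by auto
    \<comment> \<open>A connected set missing \<open>K i\<close> would lie in a single component,
      yet \<open>B\<close> meets the disjoint components \<open>F i\<close> and
      \<open>G i\<close>.\<close>
    have "B \<inter> K i \<noteq> {}"
    proof
      assume "B \<inter> K i = {}"
      then have "B \<subseteq> closure \<Omega> - K i"
        using B(1) closure_subset by blast
      then have "B \<subseteq> F i" "B \<subseteq> G i"
        using components_maximal[OF ends_component[OF F] B(2)]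
          components_maximal[OF ends_component[OF G] B(2)] f g fg by blast+
      then show False
        using disj[of i] f(1) by blast
    qed
    then have "\<exists>z\<in>B. dist 0 z \<le> r"
      using r by blast
    moreover have "f \<in> F m"
      using f ends_antimono[OF F, of m "Suc m"] by auto
    then have "f \<notin> K m" "f \<in> closure \<Omega>"
      using ends_disjoint[OF F, of m] in_components_subset[OF ends_component[OF F, of m]] by blast+
    then have "r + 1 \<le> dist 0 f"
      using m(2) by force
    ultimately show ?thesis
      using f(1) by blast
  qed
  ultimately show ?thesis
    using F G
    by (intro crossing_separationI[where V="?V" and W="?W" and r=r and R="r + 1" and c=0]) simp_all
qed

lemma crossing_separation_end_boundary:
  assumes X: "exhaustion (closure \<Omega>) K"
    and "\<zeta> \<in> end_boundary \<Omega> K" "\<eta> \<in> end_boundary \<Omega> K" "\<zeta> \<noteq> \<eta>"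
  shows "crossing_separation \<Omega> K \<zeta> \<eta>"
proof -
  have E: "F \<in> ends (closure \<Omega>) K \<and> \<not> bounded \<Omega>" if "End F \<in> end_boundary \<Omega> K" for F
    using that by (auto simp: end_boundary_def end_compactification_def split: if_splits)
  show ?thesis
  proof (cases \<zeta>)
    case (Pt x)
    then show ?thesis
      using assms E crossing_separation_Pt_Pt[OF X] crossing_separation_Pt_End[OF X]
      by (cases \<eta>) auto
  next
    case (End F)
    then show ?thesis
      using assms E crossing_separation_End_End[OF X]
        crossing_separation_sym[OF crossing_separation_Pt_End[OF X]]
      by (cases \<eta>) auto
  qed
qed

section \<open>From crossing shells to visibility\<close>

theorem theorem1p6:
  fixes \<Omega> S :: "(complex ^ 'n) set"
    and K :: "nat \<Rightarrow> (complex ^ 'n) set"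
    and lam kap :: real
  assumes "domain \<Omega>" and "hyperbolic \<Omega>"
    and "exhaustion (closure \<Omega>) K"
    and "lam \<ge> 1" and "kap \<ge> 0"
    and "S \<subseteq> frontier \<Omega>" and "totally_disconnected S"
    and "\<And>x y. \<lbrakk>x \<in> frontier \<Omega> - S; y \<in> frontier \<Omega> - S; x \<noteq> y\<rbrakk>
           \<Longrightarrow> visible_pair lam kap \<Omega> K (Pt x) (Pt y)"
  shows "visibility_domain lam kap \<Omega> K"
  unfolding visibility_domain_def
proof (intro ballI impI)
  fix \<zeta> \<eta>
  assume "\<zeta> \<in> end_boundary \<Omega> K" "\<eta> \<in> end_boundary \<Omega> K" "\<zeta> \<noteq> \<eta>"
  then have "crossing_separation \<Omega> K \<zeta> \<eta>"
    by (rule crossing_separation_end_boundary[OF assms(3)])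
  then obtain V W c r R where VW: "end_nhd \<Omega> K \<zeta> V" "end_nhd \<Omega> K \<eta> W"
      "end_closure \<Omega> K V \<inter> end_closure \<Omega> K W = {}" and "r < R"
    and cross: "\<forall>B\<subseteq>\<Omega>. connected B \<and> Pt ` B \<inter> V \<noteq> {} \<and> Pt ` B \<inter> W \<noteq> {}
      \<longrightarrow> (\<exists>x\<in>B. dist c x \<le> r) \<and> (\<exists>x\<in>B. R \<le> dist c x)"
    unfolding crossing_separation_def by (elim exE conjE) (rule that)
  have "open \<Omega>"
    using assms(1) by (simp add: domain_def)
  obtain C where C: "compact C" "C \<subseteq> \<Omega>"
    and hit: "\<And>T \<sigma>. \<lbrakk>almost_geodesic lam kap \<Omega> {0..T} \<sigma>; \<exists>s\<in>{0..T}. dist c (\<sigma> s) \<le> r;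
       \<exists>t\<in>{0..T}. R \<le> dist c (\<sigma> t)\<rbrakk> \<Longrightarrow> \<sigma> ` {0..T} \<inter> C \<noteq> {}"
    using visibility_traps_crossing_geodesics[OF \<open>open \<Omega>\<close> assms(7) \<open>r < R\<close> assms(8)] by metis
  \<comment> \<open>The image of \<open>\<sigma>\<close> is connected and meets \<open>V\<close> and
    \<open>W\<close> at its endpoints, so it crosses the shell and is caught by
    \<open>C\<close>.\<close>
  have trap: "\<sigma> ` {0..T} \<inter> C \<noteq> {}"
    if "T \<ge> 0" and ag: "almost_geodesic lam kap \<Omega> {0..T} \<sigma>" and "Pt (\<sigma> 0) \<in> V" "Pt (\<sigma> T) \<in> W" for T \<sigma>
  proof -
    have "\<sigma> ` {0..T} \<subseteq> \<Omega>" "continuous_on {0..T} \<sigma>"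
      using ag abs_continuous_on_imp_continuous_on unfolding almost_geodesic_def by blast+
    then have "connected (\<sigma> ` {0..T})"
      by (simp add: connected_continuous_image)
    moreover have "Pt ` \<sigma> ` {0..T} \<inter> V \<noteq> {}" "Pt ` \<sigma> ` {0..T} \<inter> W \<noteq> {}"
      using that by force+
    ultimately have "(\<exists>x\<in>\<sigma> ` {0..T}. dist c x \<le> r) \<and> (\<exists>x\<in>\<sigma> ` {0..T}. R \<le> dist c x)"
      by (intro cross[rule_format, OF \<open>\<sigma> ` {0..T} \<subseteq> \<Omega>\<close>] conjI)
    then show ?thesis
      using hit[OF ag] by simp
  qed
  show "visible_pair lam kap \<Omega> K \<zeta> \<eta>"
    unfolding visible_pair_def
    by (rule exI[of _ V], rule exI[of _ W], rule exI[of _ C]) (use VW C in \<open>simp add: trap\<close>)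
qed

end
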